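(* Let $(M,d)$ be a locally compact metric space. Then the collection $$\{B^{\omega}(X,r)\mid X\in \mathrm{Ran}(M),\ r>0,\ \omega \text{ a weight}\}$$ is a basis for the final topology $\tau_{\mathrm{fin}}$ on $\mathrm{Ran}(M)$.
   Context: $\mathrm{Ran}(M)$ is the set of non-empty finite subsets of $M$ (called configurations). For $n\geq 1$ let $\pi_n\colon M^n\to \mathrm{Ran}(M)$, $(x^{(1)},\dots,x^{(n)})\mapsto\{x^{(1)},\dots,x^{(n)}\}$. The final topology $\tau_{\mathrm{fin}}$ on $\mathrm{Ran}(M)$ is the finest topology making all $\pi_n$, $n\geq 1$, continuous: $U$ is open iff $\pi_n^{-1}(U)$ is open in $M^n$ for all $n\ge 1$. A weight is a non-decreasing function $\omega\colon\{1,2,3,\dots\}\to[1,\infty)$ with $\omega(1)=1$. For $X,Y\in\mathrm{Ran}(M)$, a surjective relation from $X$ to $Y$ is a subset $R\subset X\times Y$ such that every $x\in X$ is related to at least one $y\in Y$ and every $y\in Y$ is related to at least one $x\in X$; its $\omega$-length is $\ell^\omega(R)=\omega(\mathrm{card}(R))\sum_{(x,y)\in R}d(x,y)$, where $\mathrm{card}(R)$ is the number of pairs in $R$. A combinatorial chain from $X$ to $Y$ consists of configurations $X=X_0,X_1,\dots,X_k=Y$ ($k\ge 0$) and surjective relations $R_j$ from $X_j$ to $X_{j+1}$, $0\le j\le k-1$; its $\omega$-length is $\ell^\omega(R_0,\dots,R_{k-1})=\sum_{j=0}^{k-1}\ell^\omega(R_j)$. The weighted distance $d^\omega(X,Y)$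 is the infimum of the $\omega$-lengths of all combinatorial chains from $X$ to $Y$; it is a metric on $\mathrm{Ran}(M)$. $B^\omega(X,r)=\{Y\in\mathrm{Ran}(M)\mid d^\omega(X,Y)<r\}$. *)

theory Defs
  imports "HOL-Analysis.Analysis"
begin

definition Ran :: "'a set \<Rightarrow> 'a set set" where
  "Ran M = {X. X \<subseteq> M \<and> finite X \<and> X \<noteq> {}}"

text \<open>
  Points of the power \<open>M\<^sup>n\<close> are represented as extensional functions on \<open>{..<n}\<close>, so the
  product topology is the library's \<^const>\<open>product_topology\<close>.
\<close>

definition Ran_proj :: "nat \<Rightarrow> (nat \<Rightarrow> 'a) \<Rightarrow> 'a set" where
  "Ran_proj n x = x ` {..<n}"

definition Ran_final_open :: "'a topology \<Rightarrow> 'a set set \<Rightarrow> bool" where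
  "Ran_final_open T U \<longleftrightarrow> U \<subseteq> Ran (topspace T) \<and>
     (\<forall>n\<ge>1. openin (product_topology (\<lambda>_. T) {..<n})
        {x \<in> topspace (product_topology (\<lambda>_. T) {..<n}). Ran_proj n x \<in> U})"

definition Ran_final_topology :: "'a topology \<Rightarrow> 'a set topology" where
  "Ran_final_topology T = topology (Ran_final_open T)"

lemma istopology_Ran_final_open: "istopology (Ran_final_open T)"
  unfolding istopology_def
proof (intro conjI allI impI)
  fix S S' assume S: "Ran_final_open T S" and S': "Ran_final_open T S'"
  have "openin (product_topology (\<lambda>_. T) {..<n})
      {x \<in> topspace (product_topology (\<lambda>_. T) {..<n}). Ran_proj n x \<in> S \<inter> S'}"
    if "n \<ge> 1" for n
  proof -
    let ?P = "product_topology (\<lambda>_. T) {..<n}"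
    have "{x \<in> topspace ?P. Ran_proj n x \<in> S \<inter> S'} =
        {x \<in> topspace ?P. Ran_proj n x \<in> S} \<inter> {x \<in> topspace ?P. Ran_proj n x \<in> S'}"
      by blast
    then show ?thesis
      using S S' that unfolding Ran_final_open_def by (simp add: openin_Int)
  qed
  with S show "Ran_final_open T (S \<inter> S')"
    unfolding Ran_final_open_def by blast
next
  fix \<U> assume \<U>: "\<forall>U\<in>\<U>. Ran_final_open T U"
  have "openin (product_topology (\<lambda>_. T) {..<n})
      {x \<in> topspace (product_topology (\<lambda>_. T) {..<n}). Ran_proj n x \<in> \<Union>\<U>}"
    if "n \<ge> 1" for n
  proof -
    let ?P = "product_topology (\<lambda>_. T) {..<n}"
    have "{x \<in> topspace ?P. Ran_proj n x \<in> \<Union>\<U>} =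
        (\<Union>U\<in>\<U>. {x \<in> topspace ?P. Ran_proj n x \<in> U})"
      by blast
    moreover have "openin ?P {x \<in> topspace ?P. Ran_proj n x \<in> U}" if "U \<in> \<U>" for U
      using \<U> that \<open>n \<ge> 1\<close> unfolding Ran_final_open_def by simp
    then have "openin ?P (\<Union>U\<in>\<U>. {x \<in> topspace ?P. Ran_proj n x \<in> U})"
      by (intro openin_Union) blast
    ultimately show ?thesis by simp
  qed
  with \<U> show "Ran_final_open T (\<Union>\<U>)"
    unfolding Ran_final_open_def by blast
qed

lemma openin_Ran_final_topology: "openin (Ran_final_topology T) = Ran_final_open T"
  unfolding Ran_final_topology_def
  using istopology_Ran_final_open by (rule topology_inverse')

lemma Ran_proj_in_Ran:
  assumes "n \<ge> 1" and "x \<in> topspace (product_topology (\<lambda>_. T) {..<n})"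
  shows "Ran_proj n x \<in> Ran (topspace T)"
proof -
  have "0 \<in> {..<n}" using assms(1) by simp
  then show ?thesis
    using assms(2) by (auto simp: Ran_proj_def Ran_def PiE_iff simp del: lessThan_iff)
qed

lemma topspace_Ran_final_topology: "topspace (Ran_final_topology T) = Ran (topspace T)"
proof
  show "topspace (Ran_final_topology T) \<subseteq> Ran (topspace T)"
    using openin_topspace[of "Ran_final_topology T"]
    unfolding openin_Ran_final_topology Ran_final_open_def by (rule conjunct1)
  have "openin (product_topology (\<lambda>_. T) {..<n})
      {x \<in> topspace (product_topology (\<lambda>_. T) {..<n}). Ran_proj n x \<in> Ran (topspace T)}"
    if "n \<ge> 1" for n
  proof -
    let ?P = "product_topology (\<lambda>_. T) {..<n}"
    have "{x \<in> topspace ?P. Ran_proj n x \<in> Ran (topspace T)} = topspace ?P"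
      using Ran_proj_in_Ran[OF that] by blast
    then show ?thesis by (simp only: openin_topspace)
  qed
  then have "openin (Ran_final_topology T) (Ran (topspace T))"
    by (simp add: openin_Ran_final_topology Ran_final_open_def)
  then show "Ran (topspace T) \<subseteq> topspace (Ran_final_topology T)"
    by (rule openin_subset)
qed

text \<open>
  The following predicate is the counterpart of \<^const>\<open>topological_basis\<close> for topologies given as
  objects of type \<open>'a topology\<close>.
\<close>

definition topology_basis :: "'a topology \<Rightarrow> 'a set set \<Rightarrow> bool" where
  "topology_basis T \<B> \<longleftrightarrow>
     (\<forall>B\<in>\<B>. openin T B) \<and> (\<forall>U. openin T U \<longrightarrow> (\<exists>\<B>'\<subseteq>\<B>. \<Union>\<B>' = U))"

text \<open>
  A weight has domain \<open>{1, 2, 3, \<dots>}\<close>. Its value at \<open>0\<close> is unconstrained and irrelevant: a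
  surjective relation between configurations is finite and nonempty.
\<close>

definition weight :: "(nat \<Rightarrow> real) \<Rightarrow> bool" where
  "weight \<omega> \<longleftrightarrow> (\<forall>n\<ge>1. 1 \<le> \<omega> n) \<and> mono_on {1..} \<omega> \<and> \<omega> 1 = 1"

definition surjective_relation :: "'a set \<Rightarrow> 'a set \<Rightarrow> ('a \<times> 'a) set \<Rightarrow> bool" where
  "surjective_relation X Y R \<longleftrightarrow>
     R \<subseteq> X \<times> Y \<and> (\<forall>x\<in>X. \<exists>y\<in>Y. (x, y) \<in> R) \<and> (\<forall>y\<in>Y. \<exists>x\<in>X. (x, y) \<in> R)"

definition relation_length ::
    "('a \<Rightarrow> 'a \<Rightarrow> real) \<Rightarrow> (nat \<Rightarrow> real) \<Rightarrow> ('a \<times> 'a) set \<Rightarrow> real" where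
  "relation_length d \<omega> R = \<omega> (card R) * (\<Sum>(x, y)\<in>R. d x y)"

text \<open>
  A combinatorial chain with \<open>k\<close> steps is encoded by sequences \<open>Xs\<close> and \<open>Rs\<close> of which only
  \<open>Xs 0, \<dots>, Xs k\<close> and \<open>Rs 0, \<dots>, Rs (k - 1)\<close> are relevant.
\<close>

definition combinatorial_chain ::
    "'a set \<Rightarrow> 'a set \<Rightarrow> 'a set \<Rightarrow> nat \<Rightarrow> (nat \<Rightarrow> 'a set) \<Rightarrow> (nat \<Rightarrow> ('a \<times> 'a) set) \<Rightarrow> bool" where
  "combinatorial_chain M X Y k Xs Rs \<longleftrightarrow>
     Xs 0 = X \<and> Xs k = Y \<and> (\<forall>j\<le>k. Xs j \<in> Ran M) \<and>
     (\<forall>j<k. surjective_relation (Xs j) (Xs (Suc j)) (Rs j))"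

definition chain_length ::
    "('a \<Rightarrow> 'a \<Rightarrow> real) \<Rightarrow> (nat \<Rightarrow> real) \<Rightarrow> nat \<Rightarrow> (nat \<Rightarrow> ('a \<times> 'a) set) \<Rightarrow> real" where
  "chain_length d \<omega> k Rs = (\<Sum>j<k. relation_length d \<omega> (Rs j))"

text \<open>
  For configurations \<open>X\<close> and \<open>Y\<close> and a weight \<open>\<omega>\<close>, the infimum is over a set that is bounded
  below by \<open>0\<close> and nonempty, as \<open>X \<times> Y\<close> is itself a surjective relation.
\<close>

definition weighted_dist ::
    "'a set \<Rightarrow> ('a \<Rightarrow> 'a \<Rightarrow> real) \<Rightarrow> (nat \<Rightarrow> real) \<Rightarrow> 'a set \<Rightarrow> 'a set \<Rightarrow> real" where
  "weighted_dist M d \<omega> X Y =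
     Inf {chain_length d \<omega> k Rs | k Xs Rs. combinatorial_chain M X Y k Xs Rs}"

definition weighted_ball ::
    "'a set \<Rightarrow> ('a \<Rightarrow> 'a \<Rightarrow> real) \<Rightarrow> (nat \<Rightarrow> real) \<Rightarrow> 'a set \<Rightarrow> real \<Rightarrow> 'a set set" where
  "weighted_ball M d \<omega> X r = {Y \<in> Ran M. weighted_dist M d \<omega> X Y < r}"

end

theory Submission
  imports Defs
begin

text \<open>
  Weighted balls are open because a single surjective relation extends a chain: if \<open>x\<close> and \<open>y\<close> are
  nearby tuples in \<open>M\<^sup>n\<close>, the pairs \<open>(x i, y i)\<close> form a surjective relation with at most \<open>n\<close>
  elements between the two configurations, so that its length is at most \<open>\<omega> n\<close> times
  \<open>\<Sum>i<n. d (x i) (y i)\<close> (\<open>Ran_final_open_weighted_ball\<close>).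

  The substance is the converse: an open set \<open>U\<close> of the final topology contains a weighted ball around
  each of its configurations \<open>X\<close> (\<open>weighted_ball_inside_final_open\<close>). Local compactness provides a
  compact \<open>K\<close> that contains a neighbourhood of every point of \<open>X\<close>. With respect to the Hausdorff
  metric the configurations in \<open>K\<close> with at most \<open>n\<close> points form a compact set \<open>Z n\<close>, being a
  continuous image of \<open>K\<^sup>n\<close>, and so do those of them that lie outside \<open>U\<close>. A real function \<open>f\<close> is
  constructed on the union of the \<open>Z n\<close> that vanishes at \<open>X\<close>, exceeds \<open>1\<close> outside \<open>U\<close>, and is Lipschitz
  on each \<open>Z n\<close>, with constants that may grow with \<open>n\<close>. The weight \<open>\<omega>\<close> is this sequence of constants,
  normalised to start with \<open>1\<close>. A relation with \<open>n\<close> pairs connects two configurations of \<open>Z n\<close>, and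
  their Hausdorff distance is at most the sum of \<open>d\<close> over the pairs. Hence, up to the normalisation,
  \<open>f\<close> increases along a chain by at most the \<open>\<omega>\<close>-length, and a short chain from \<open>X\<close> cannot leave \<open>U\<close>.
  As \<open>\<omega> \<ge> 1\<close>, the \<open>\<omega>\<close>-length also bounds the Hausdorff distance from \<open>X\<close>, which keeps a short chain
  inside \<open>K\<close>.

  The function is built by extending it from one \<open>Z n\<close> to the next with McShane's formula
  (\<open>Lipschitz_extension_above_1\<close>). The strict inequality \<open>f > 1\<close> outside \<open>U\<close> makes this possible:
  by compactness it survives the extension if the new Lipschitz constant is large enough. Prescribing
  the value \<open>1\<close> there would not work, since the part of \<open>Z (n + 1)\<close> outside \<open>U\<close> may be tangent to \<open>Z n\<close>,
  and then a Lipschitz extension with these values need not exist.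
\<close>

section \<open>The Hausdorff metric on configurations\<close>

definition hausdorff_close :: "('a \<Rightarrow> 'a \<Rightarrow> real) \<Rightarrow> real \<Rightarrow> 'a set \<Rightarrow> 'a set \<Rightarrow> bool" where
  "hausdorff_close d e A B \<longleftrightarrow>
     (\<forall>a\<in>A. \<exists>b\<in>B. d a b \<le> e) \<and> (\<forall>b\<in>B. \<exists>a\<in>A. d a b \<le> e)"

text \<open>
  The value \<open>0\<close> outside \<^term>\<open>Ran M\<close> is there because \<^locale>\<open>Metric_space\<close> demands nonnegativity
  and symmetry for all arguments, not only for those in the carrier.
\<close>

definition hausdorff_dist ::
    "'a set \<Rightarrow> ('a \<Rightarrow> 'a \<Rightarrow> real) \<Rightarrow> 'a set \<Rightarrow> 'a set \<Rightarrow> real" where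
  "hausdorff_dist M d A B =
     (if A \<in> Ran M \<and> B \<in> Ran M then Inf {e. 0 \<le> e \<and> hausdorff_close d e A B} else 0)"

lemma surjective_relation_finite:
  assumes "surjective_relation A B R" "A \<in> Ran M" "B \<in> Ran N"
  shows "finite R"
  using assms unfolding surjective_relation_def Ran_def
  by (auto intro: finite_subset)

lemma surjective_relation_card:
  assumes "surjective_relation A B R" "finite R"
  shows "card A \<le> card R" "card B \<le> card R"
proof -
  have "A = fst ` R" "B = snd ` R"
    using assms(1) unfolding surjective_relation_def by force+
  then show "card A \<le> card R" "card B \<le> card R"
    using card_image_le[OF assms(2)] by blast+
qed

lemma surjective_relation_card_ge_1:
  assumes R: "surjective_relation A B R" and A: "A \<in> Ran M" and B: "B \<in> Ran N"
  shows "1 \<le> card R"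
proof -
  have "card A \<noteq> 0" using A by (auto simp: Ran_def)
  then show ?thesis
    using surjective_relation_card(1)[OF R surjective_relation_finite[OF R A B]] by simp
qed

lemma surjective_relation_Times:
  assumes "A \<in> Ran M" "B \<in> Ran M"
  shows "surjective_relation A B (A \<times> B)"
  using assms unfolding surjective_relation_def Ran_def by blast

context Metric_space
begin

lemma hausdorff_close_relation:
  assumes R: "surjective_relation A B R" "finite R"
  shows "hausdorff_close d (\<Sum>(x, y)\<in>R. d x y) A B"
proof -
  have le: "d a b \<le> (\<Sum>(x, y)\<in>R. d x y)" if "(a, b) \<in> R" for a b
    using member_le_sum[OF that, of "\<lambda>(x, y). d x y"] R(2) by auto
  show ?thesis
    using R(1) le unfolding surjective_relation_def hausdorff_close_def by meson
qed

lemma hausdorff_dist_le: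
  assumes "A \<in> Ran M" "B \<in> Ran M" "0 \<le> e" "hausdorff_close d e A B"
  shows "hausdorff_dist M d A B \<le> e"
  unfolding hausdorff_dist_def using assms
  by (auto intro!: cInf_lower bdd_belowI[of _ 0])

text \<open>
  The link between the Hausdorff metric and lengths of chains: each point is moved by at most the
  sum of all distances in the relation.
\<close>

lemma hausdorff_dist_le_relation:
  assumes R: "surjective_relation A B R" and AB: "A \<in> Ran M" "B \<in> Ran M"
  shows "hausdorff_dist M d A B \<le> (\<Sum>(x, y)\<in>R. d x y)"
  using AB by (intro hausdorff_dist_le hausdorff_close_relation R surjective_relation_finite[OF R])
    (auto intro: sum_nonneg)

lemma hausdorff_close_nonempty:
  assumes AB: "A \<in> Ran M" "B \<in> Ran M"
  shows "{e. 0 \<le> e \<and> hausdorff_close d e A B} \<noteq> {}"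
proof -
  have "hausdorff_close d (\<Sum>(x, y)\<in>A \<times> B. d x y) A B"
    using surjective_relation_Times[OF AB] surjective_relation_finite AB
    by (intro hausdorff_close_relation) blast+
  moreover have "0 \<le> (\<Sum>(x, y)\<in>A \<times> B. d x y)"
    by (auto intro: sum_nonneg)
  ultimately show ?thesis by blast
qed

lemma hausdorff_dist_less_imp_close:
  assumes AB: "A \<in> Ran M" "B \<in> Ran M" and less: "hausdorff_dist M d A B < e"
  shows "hausdorff_close d e A B"
proof -
  have "Inf {e. 0 \<le> e \<and> hausdorff_close d e A B} < e"
    using AB less by (simp add: hausdorff_dist_def)
  then obtain e' where "e' < e" "hausdorff_close d e' A B"
    using cInf_lessD[OF hausdorff_close_nonempty[OF AB]] by blast
  then show ?thesis
    unfolding hausdorff_close_def by (meson less_imp_le order_trans)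
qed

lemma hausdorff_dist_nonneg: "0 \<le> hausdorff_dist M d A B"
  unfolding hausdorff_dist_def using hausdorff_close_nonempty
  by (auto intro!: cInf_greatest)

lemma hausdorff_dist_eq_0_imp_subset:
  assumes AB: "A \<in> Ran M" "B \<in> Ran M" and eq0: "hausdorff_dist M d A B = 0"
  shows "A \<subseteq> B"
proof
  fix a assume a: "a \<in> A"
  show "a \<in> B"
  proof (rule ccontr)
    assume nb: "a \<notin> B"
    define \<delta> where "\<delta> = Min (d a ` B)"
    have B: "finite B" "B \<noteq> {}" "B \<subseteq> M" "a \<in> M"
      using AB a by (auto simp: Ran_def)
    have "0 < d a b" if "b \<in> B" for b
      using that nb B by (metis mdist_pos_eq subsetD)
    then have "0 < \<delta>"
      using B by (simp add: \<delta>_def)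
    then obtain b where "b \<in> B" "d a b \<le> \<delta> / 2"
      using hausdorff_dist_less_imp_close[OF AB, of "\<delta> / 2"] eq0 a
      by (auto simp: hausdorff_close_def)
    moreover have "\<delta> \<le> d a b"
      using \<open>b \<in> B\<close> B by (simp add: \<delta>_def)
    ultimately show False
      using \<open>0 < \<delta>\<close> by simp
  qed
qed

lemma hausdorff_dist_commute: "hausdorff_dist M d A B = hausdorff_dist M d B A"
proof -
  have "hausdorff_close d e A B \<longleftrightarrow> hausdorff_close d e B A" for e
    unfolding hausdorff_close_def by (metis commute)
  then show ?thesis by (simp add: hausdorff_dist_def)
qed

lemma Metric_space_hausdorff: "Metric_space (Ran M) (hausdorff_dist M d)"
proof
  fix A B C
  show "0 \<le> hausdorff_dist M d A B" by (rule hausdorff_dist_nonneg)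
  show "hausdorff_dist M d A B = hausdorff_dist M d B A" by (rule hausdorff_dist_commute)
  assume A: "A \<in> Ran M" and B: "B \<in> Ran M"
  have "hausdorff_dist M d A A \<le> 0" if "A \<in> Ran M"
  proof (intro hausdorff_dist_le that)
    have "d a a \<le> 0" if "a \<in> A" for a
      using \<open>A \<in> Ran M\<close> that by (auto simp: Ran_def)
    then show "hausdorff_close d 0 A A"
      unfolding hausdorff_close_def by blast
  qed simp
  then show "hausdorff_dist M d A B = 0 \<longleftrightarrow> A = B"
    using A B hausdorff_dist_eq_0_imp_subset hausdorff_dist_commute hausdorff_dist_nonneg
    by (metis order_antisym)
  assume C: "C \<in> Ran M"
  show "hausdorff_dist M d A C \<le> hausdorff_dist M d A B + hausdorff_dist M d B C"
  proof (rule field_le_epsilon)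
    fix e :: real assume e: "0 < e"
    define p where "p = hausdorff_dist M d A B + e / 2"
    define q where "q = hausdorff_dist M d B C + e / 2"
    have p: "hausdorff_close d p A B" and q: "hausdorff_close d q B C"
      unfolding p_def q_def using e A B C by (auto intro: hausdorff_dist_less_imp_close)
    have M: "A \<subseteq> M" "B \<subseteq> M" "C \<subseteq> M" using A B C by (auto simp: Ran_def)
    have tri: "d a c \<le> p + q"
      if "a \<in> A" "b \<in> B" "c \<in> C" "d a b \<le> p" "d b c \<le> q" for a b c
      using triangle[of a b c] that M by (smt (verit) subsetD)
    have "hausdorff_close d (p + q) A C"
      using p q tri unfolding hausdorff_close_def by meson
    moreover have "0 \<le> p + q"
      using e by (simp add: p_def q_def hausdorff_dist_nonneg add_nonneg_nonneg)
    ultimately have "hausdorff_dist M d A C \<le> p + q"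
      using A C by (intro hausdorff_dist_le)
    then show "hausdorff_dist M d A C \<le> hausdorff_dist M d A B + hausdorff_dist M d B C + e"
      by (simp add: p_def q_def)
  qed
qed

section \<open>Tuples and configurations\<close>

text \<open>
  The cardinality can be smaller than \<open>n\<close> because pairs \<open>(x i, y i)\<close> may coincide for different \<open>i\<close>;
  weights are monotone, so only the upper bound matters.
\<close>

lemma tuple_relation:
  fixes n :: nat
  assumes xy: "x \<in> topspace (product_topology (\<lambda>_. mtopology) {..<n})"
    "y \<in> topspace (product_topology (\<lambda>_. mtopology) {..<n})"
  obtains R where "surjective_relation (Ran_proj n x) (Ran_proj n y) R" "card R \<le> n"
    "(\<Sum>(a, b)\<in>R. d a b) \<le> (\<Sum>i<n. d (x i) (y i))"
proof
  let ?R = "(\<lambda>i. (x i, y i)) ` {..<n}"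
  show "surjective_relation (Ran_proj n x) (Ran_proj n y) ?R"
    by (auto simp: surjective_relation_def Ran_proj_def)
  show "card ?R \<le> n"
    using card_image_le[of "{..<n}" "\<lambda>i. (x i, y i)"] by simp
  show "(\<Sum>(a, b)\<in>?R. d a b) \<le> (\<Sum>i<n. d (x i) (y i))"
    using sum_image_le[of "{..<n}" "\<lambda>(a, b). d a b" "\<lambda>i. (x i, y i)"] by (simp add: o_def)
qed

lemma tuple_neighbourhood:
  fixes n :: nat and e :: real
  assumes x: "x \<in> topspace (product_topology (\<lambda>_. mtopology) {..<n})" and "n \<ge> 1" "0 < e"
  obtains W where "openin (product_topology (\<lambda>_. mtopology) {..<n}) W" "x \<in> W"
    "\<And>y. y \<in> W \<Longrightarrow> (\<Sum>i<n. d (x i) (y i)) < e"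
proof
  let ?W = "PiE {..<n} (\<lambda>i. mball (x i) (e / real n))"
  show "openin (product_topology (\<lambda>_. mtopology) {..<n}) ?W"
    by (auto simp: openin_PiE)
  have "x i \<in> M" if "i < n" for i
    using x that by (auto simp: PiE_iff)
  then show "x \<in> ?W"
    using x assms by (auto simp: PiE_iff)
  fix y assume "y \<in> ?W"
  then have "d (x i) (y i) < e / real n" if "i < n" for i
    using that by (auto simp: PiE_iff)
  then have "(\<Sum>i<n. d (x i) (y i)) < of_nat (card {..<n}) * (e / real n)"
    using assms(2) by (intro sum_bounded_above_strict) auto
  then show "(\<Sum>i<n. d (x i) (y i)) < e"
    using assms(2) by simp
qed

lemma continuous_map_Ran_proj:
  assumes n: "n \<ge> 1"
  shows "continuous_map (product_topology (\<lambda>_. mtopology) {..<n})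
           (Metric_space.mtopology (Ran M) (hausdorff_dist M d)) (Ran_proj n)"
proof -
  interpret H: Metric_space "Ran M" "hausdorff_dist M d" by (rule Metric_space_hausdorff)
  let ?P = "product_topology (\<lambda>_. mtopology) {..<n}"
  have ran: "Ran_proj n x \<in> Ran M" if "x \<in> topspace ?P" for x
    using Ran_proj_in_Ran[OF n that] by simp
  show ?thesis
    unfolding H.continuous_map_to_metric
  proof (intro ballI allI impI)
    fix x \<epsilon> assume x: "x \<in> topspace ?P" and "(0::real) < \<epsilon>"
    then obtain W where W: "openin ?P W" "x \<in> W"
      and near: "\<And>y. y \<in> W \<Longrightarrow> (\<Sum>i<n. d (x i) (y i)) < \<epsilon>"
      using tuple_neighbourhood n by metis
    have "Ran_proj n y \<in> H.mball (Ran_proj n x) \<epsilon>" if "y \<in> W" for y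
    proof -
      have y: "y \<in> topspace ?P"
        using W(1) that openin_subset by blast
      obtain R where "surjective_relation (Ran_proj n x) (Ran_proj n y) R"
        "(\<Sum>(a, b)\<in>R. d a b) \<le> (\<Sum>i<n. d (x i) (y i))"
        using tuple_relation[OF x y] by metis
      then have "hausdorff_dist M d (Ran_proj n x) (Ran_proj n y) < \<epsilon>"
        using hausdorff_dist_le_relation[OF _ ran[OF x] ran[OF y]] near[OF that]
        by (meson order_le_less_trans order_trans)
      then show ?thesis using ran[OF x] ran[OF y] by simp
    qed
    with W show "\<exists>U. openin ?P U \<and> x \<in> U \<and> (\<forall>y\<in>U. Ran_proj n y \<in> H.mball (Ran_proj n x) \<epsilon>)"
      by blast
  qed
qed

end

text \<open>
  The image contains the configurations with fewer than \<open>n\<close> points as well, because a tuple may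
  repeat a point. This is what makes the images increase with \<open>n\<close>.
\<close>

lemma Ran_proj_image_PiE:
  assumes n: "n \<ge> 1"
  shows "Ran_proj n ` PiE {..<n} (\<lambda>_. K) = {A \<in> Ran K. card A \<le> n}"
proof
  show "Ran_proj n ` PiE {..<n} (\<lambda>_. K) \<subseteq> {A \<in> Ran K. card A \<le> n}"
    using n card_image_le[of "{..<n}"]
    by (auto simp: Ran_proj_def Ran_def PiE_iff lessThan_empty_iff)
next
  show "{A \<in> Ran K. card A \<le> n} \<subseteq> Ran_proj n ` PiE {..<n} (\<lambda>_. K)"
  proof
    fix A assume "A \<in> {A \<in> Ran K. card A \<le> n}"
    then have A: "A \<subseteq> K" "finite A" "A \<noteq> {}" "card A \<le> n" by (auto simp: Ran_def)
    obtain h where h: "bij_betw h {0..<card A} A"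
      using ex_bij_betw_nat_finite[OF A(2)] by blast
    have hA: "h ` {0..<card A} = A" using h by (simp add: bij_betw_def)
    have c: "0 < card A" using A by (simp add: card_gt_0_iff)
    \<comment> \<open>An enumeration of A, padded with repetitions of its first point.\<close>
    define x where "x i = (if i < card A then h i else if i < n then h 0 else undefined)" for i
    have "x ` {..<n} = A"
    proof
      show "x ` {..<n} \<subseteq> A"
        using c hA by (auto simp: x_def)
      show "A \<subseteq> x ` {..<n}"
      proof
        fix a assume "a \<in> A"
        then obtain i where "i < card A" "a = h i" using hA by (metis atLeastLessThan_iff imageE)
        then show "a \<in> x ` {..<n}" using A(4) by (auto simp: x_def intro!: image_eqI[of _ _ i])
      qed
    qed
    moreover from this have "x \<in> PiE {..<n} (\<lambda>_. K)"
      using A by (auto simp: PiE_iff extensional_def x_def)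
    ultimately show "A \<in> Ran_proj n ` PiE {..<n} (\<lambda>_. K)"
      by (auto simp: Ran_proj_def intro!: image_eqI[of _ _ x])
  qed
qed

context Metric_space
begin

lemma compactin_bounded_card:
  assumes K: "compactin mtopology K" and n: "n \<ge> 1"
  shows "compactin (Metric_space.mtopology (Ran M) (hausdorff_dist M d)) {A \<in> Ran K. card A \<le> n}"
proof -
  have "compactin (product_topology (\<lambda>_. mtopology) {..<n}) (PiE {..<n} (\<lambda>_. K))"
    using K by (simp add: compactin_PiE)
  from image_compactin[OF this continuous_map_Ran_proj[OF n]] show ?thesis
    by (simp only: Ran_proj_image_PiE[OF n])
qed

text \<open>
  The final topology enters here: the tuples in \<open>K\<^sup>n\<close> whose configuration is not in \<open>U\<close> form a
  closed subset of a compact set. In general \<open>U\<close> is not open for the Hausdorff metric, which is why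
  the cardinality has to be bounded.
\<close>

lemma compactin_bounded_card_minus_open:
  assumes K: "compactin mtopology K" and n: "n \<ge> 1" and U: "Ran_final_open mtopology U"
  shows "compactin (Metric_space.mtopology (Ran M) (hausdorff_dist M d))
           ({A \<in> Ran K. card A \<le> n} - U)"
proof -
  let ?P = "product_topology (\<lambda>_. mtopology) {..<n}"
  let ?V = "{x \<in> topspace ?P. Ran_proj n x \<in> U}"
  let ?K = "PiE {..<n} (\<lambda>_. K)"
  have KP: "?K \<subseteq> topspace ?P"
    using compactin_subset_topspace[OF K] by (auto simp: PiE_iff)
  have "compactin ?P ?K"
    using K by (simp add: compactin_PiE)
  moreover have "openin ?P ?V"
    using U n by (simp add: Ran_final_open_def)
  then have "closedin ?P (topspace ?P - ?V)" by (rule closedin_diff[OF closedin_topspace])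
  ultimately have "compactin ?P ((topspace ?P - ?V) \<inter> ?K)"
    by (intro closed_Int_compactin)
  from image_compactin[OF this continuous_map_Ran_proj[OF n]]
  have "compactin (Metric_space.mtopology (Ran M) (hausdorff_dist M d))
          (Ran_proj n ` ((topspace ?P - ?V) \<inter> ?K))" .
  moreover have "Ran_proj n ` ((topspace ?P - ?V) \<inter> ?K) = Ran_proj n ` ?K - U"
    using KP by auto
  ultimately show ?thesis
    by (simp only: Ran_proj_image_PiE[OF n])
qed

section \<open>Lipschitz functions on an increasing union of compact sets\<close>

text \<open>
  The extension is \<open>F c x = (INF a\<in>S. f a + c * d a x)\<close>. If it failed to exceed \<open>1\<close> on \<open>Q\<close> for
  arbitrarily large \<open>c\<close>, there would be points \<open>b\<close> of \<open>Q\<close> and \<open>a\<close> of \<open>S\<close> with \<open>f a + c * d a b\<close> almost at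
  most \<open>1\<close>. As \<open>f\<close> is nonnegative, the distance \<open>d a b\<close> then tends to \<open>0\<close>, and an accumulation point of
  these points lies in \<open>Q \<inter> S\<close> and has \<open>f \<le> 1\<close>.
\<close>

lemma Lipschitz_extension_above_1:
  assumes S: "compactin mtopology S" "S \<noteq> {}" and ST: "S \<subseteq> T" "T \<subseteq> M"
    and Q: "compactin mtopology Q" "Q \<subseteq> T" and L: "0 \<le> L"
    and f0: "\<And>x. x \<in> S \<Longrightarrow> 0 \<le> f x"
    and lip: "\<And>x y. x \<in> S \<Longrightarrow> y \<in> S \<Longrightarrow> f x \<le> f y + L * d x y"
    and f1: "\<And>x. x \<in> Q \<inter> S \<Longrightarrow> 1 < f x"
  obtains g L' where "L \<le> L'" "\<And>x. x \<in> S \<Longrightarrow> g x = f x" "\<And>x. x \<in> T \<Longrightarrow> 0 \<le> g x"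
    "\<And>x y. x \<in> T \<Longrightarrow> y \<in> T \<Longrightarrow> g x \<le> g y + L' * d x y" "\<And>x. x \<in> Q \<Longrightarrow> (1::real) < g x"
proof -
  define F where "F c x = (INF a\<in>S. f a + c * d a x)" for c x
  have SM: "S \<subseteq> M" using ST by blast
  have bdd: "bdd_below ((\<lambda>a. f a + c * d a x) ` S)" if "0 \<le> c" for c x
    using f0 that by (intro bdd_belowI2[of _ 0]) auto
  have ext: "F c x = f x" if c: "L \<le> c" and x: "x \<in> S" for c x
  proof (rule order_antisym)
    have "F c x \<le> f x + c * d x x"
      unfolding F_def using L c x by (intro cINF_lower bdd) auto
    then show "F c x \<le> f x" using x SM by auto
    have "f x \<le> f a + c * d a x" if "a \<in> S" for a
      using lip[OF x that] mult_right_mono[OF c nonneg[of a x]] by (simp add: commute[of x a])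
    then show "f x \<le> F c x"
      unfolding F_def using S(2) by (intro cINF_greatest)
  qed
  have pos: "0 \<le> F c x" if "L \<le> c" for c x
    unfolding F_def using S(2) f0 L that by (intro cINF_greatest) auto
  have Flip: "F c x \<le> F c y + c * d x y" if c: "L \<le> c" and xy: "x \<in> T" "y \<in> T" for c x y
  proof -
    have "F c x - c * d x y \<le> f a + c * d a y" if a: "a \<in> S" for a
    proof -
      have "F c x \<le> f a + c * d a x"
        unfolding F_def using L c a by (intro cINF_lower bdd) auto
      moreover have "d a x \<le> d a y + d x y"
        using triangle[of a y x] a xy ST commute[of x y] by auto
      then have "c * d a x \<le> c * d a y + c * d x y"
        using L c by (metis distrib_left mult_left_mono order_trans)
      ultimately show ?thesis by simp
    qed
    then have "F c x - c * d x y \<le> F c y"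
      unfolding F_def[of c y] using S(2) by (intro cINF_greatest)
    then show ?thesis by simp
  qed
  have "\<exists>k::nat. \<forall>x\<in>Q. 1 < F (L + k) x"
  proof (rule ccontr)
    assume "\<not> ?thesis"
    then have "\<forall>k::nat. \<exists>b. b \<in> Q \<and> F (L + k) b \<le> 1"
      by (meson linorder_not_le)
    from choice[OF this] obtain b :: "nat \<Rightarrow> 'a"
      where "\<forall>k. b k \<in> Q \<and> F (L + k) (b k) \<le> 1" ..
    then have b: "b k \<in> Q \<and> F (L + k) (b k) \<le> 1" for k :: nat
      by (rule spec)
    have "\<exists>a\<in>S. f a + (L + k) * d a (b k) < 1 + 1 / Suc k" for k :: nat
    proof -
      have "F (L + k) (b k) < 1 + 1 / Suc k"
        using b[of k] by (auto intro: le_less_trans)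
      then show ?thesis
        using cINF_less_iff[OF S(2) bdd] L unfolding F_def by auto
    qed
    then have "\<forall>k::nat. \<exists>a. a \<in> S \<and> f a + (L + k) * d a (b k) < 1 + 1 / Suc k"
      by blast
    from choice[OF this] obtain a :: "nat \<Rightarrow> 'a"
      where "\<forall>k. a k \<in> S \<and> f (a k) + (L + k) * d (a k) (b k) < 1 + 1 / Suc k" ..
    then have a: "a k \<in> S" and ak: "f (a k) + (L + k) * d (a k) (b k) < 1 + 1 / Suc k"
      for k :: nat
      by simp_all
    obtain l r where l: "l \<in> Q" "strict_mono r" "limitin mtopology (b \<circ> r) l sequentially"
      using Q(1) b unfolding compactin_sequentially by (metis image_subsetI)
    have bl: "(\<lambda>k. d (b (r k)) l) \<longlonglongrightarrow> 0"
      using l(3) by (simp add: limitin_metric_dist_null o_def)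
    \<comment> \<open>Here f must be nonnegative: only the distance term remains, and its coefficient is at least k.\<close>
    have "d (a k) (b k) \<le> 2 / k" if "k \<ge> 1" for k :: nat
    proof -
      have "k * d (a k) (b k) \<le> f (a k) + (L + real k) * d (a k) (b k)"
        using f0[OF a] L by (simp add: distrib_right)
      also have "\<dots> \<le> 2"
        using ak[of k] by (smt (verit) divide_le_eq_1_pos of_nat_0_less_iff of_nat_Suc of_nat_0_le_iff)
      finally show ?thesis using that by (simp add: field_simps)
    qed
    then have "\<forall>\<^sub>F k in sequentially. norm (d (a k) (b k)) \<le> 2 / k"
      by (auto simp: eventually_sequentially intro!: exI[of _ 1])
    moreover have "(\<lambda>k::nat. 2 / real k) \<longlonglongrightarrow> 0"
      by (rule lim_const_over_n)
    ultimately have "(\<lambda>k. d (a k) (b k)) \<longlonglongrightarrow> 0"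
      by (rule Lim_null_comparison)
    then have ab: "(\<lambda>k. d (a (r k)) (b (r k))) \<longlonglongrightarrow> 0"
      using LIMSEQ_subseq_LIMSEQ[OF _ l(2)] by (force simp: o_def)
    have lM: "l \<in> M" and bM: "b k \<in> M" and aM: "a k \<in> M" for k
      using l(1) b a Q(2) ST by blast+
    have al: "(\<lambda>k. d (a (r k)) l) \<longlonglongrightarrow> 0"
    proof (rule Lim_null_comparison)
      show "\<forall>\<^sub>F k in sequentially. norm (d (a (r k)) l) \<le> d (a (r k)) (b (r k)) + d (b (r k)) l"
        using triangle aM bM lM by simp
      show "(\<lambda>k. d (a (r k)) (b (r k)) + d (b (r k)) l) \<longlonglongrightarrow> 0"
        using tendsto_add[OF ab bl] by simp
    qed
    then have "limitin mtopology (a \<circ> r) l sequentially"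
      using aM lM by (simp add: limitin_metric_dist_null o_def)
    moreover have "closedin mtopology S"
      using compactin_imp_closedin[OF Hausdorff_space_mtopology S(1)] .
    ultimately have lS: "l \<in> S"
      using a unfolding metric_closedin_iff_sequentially_closed by (metis image_subsetI o_apply)
    have "f l \<le> 1"
    proof (rule LIMSEQ_le_const)
      have "(\<lambda>k. 1 + 1 / real (Suc k)) \<longlonglongrightarrow> 1 + 0"
        by (intro tendsto_intros LIMSEQ_Suc[OF lim_1_over_n])
      then have "(\<lambda>k. 1 + 1 / real (Suc (r k))) \<longlonglongrightarrow> 1"
        using LIMSEQ_subseq_LIMSEQ[OF _ l(2)] by (force simp: o_def)
      then have "(\<lambda>k. (1 + 1 / real (Suc (r k))) + L * d (a (r k)) l) \<longlonglongrightarrow> 1 + L * 0"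
        by (intro tendsto_intros al)
      then show "(\<lambda>k. (1 + 1 / real (Suc (r k))) + L * d (a (r k)) l) \<longlonglongrightarrow> 1" by simp
      have "f l \<le> 1 + 1 / real (Suc (r k)) + L * d (a (r k)) l" for k
      proof -
        have "0 \<le> (L + real (r k)) * d (a (r k)) (b (r k))" using L by simp
        then show ?thesis
          using lip[OF lS a[of "r k"]] ak[of "r k"] by (simp add: commute[of l])
      qed
      then show "\<exists>N. \<forall>k\<ge>N. f l \<le> 1 + 1 / real (Suc (r k)) + L * d (a (r k)) l" by blast
    qed
    with f1[of l] l(1) lS show False by auto
  qed
  then obtain k :: nat where "\<And>x. x \<in> Q \<Longrightarrow> 1 < F (L + k) x" by blast
  then show ?thesis
    using that[of "L + k" "F (L + k)"] ext pos Flip by simp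
qed

text \<open>
  The extension lemma is iterated along the \<open>S n\<close>. The starting point is the zero function on \<open>{p}\<close>,
  so that the first function, on \<open>S 0\<close>, is itself obtained by an extension.
\<close>

lemma Lipschitz_separation_on_union:
  fixes S :: "nat \<Rightarrow> 'a set"
  assumes S: "\<And>n. compactin mtopology (S n)" "\<And>n. S n \<subseteq> S (Suc n)"
    and SU: "\<And>n. compactin mtopology (S n - U)" and p: "p \<in> S 0" "p \<in> U"
  obtains f :: "'a \<Rightarrow> real" and L :: "nat \<Rightarrow> real" where "0 < L 0" "incseq L" "f p = 0"
    "\<And>n x y. x \<in> S n \<Longrightarrow> y \<in> S n \<Longrightarrow> f x \<le> f y + L n * d x y"
    "\<And>n x. x \<in> S n - U \<Longrightarrow> 1 < f x"
proof -
  have SM: "S n \<subseteq> M" for n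
    using compactin_subset_topspace[OF S(1)] by simp
  have pM: "p \<in> M" using p SM by blast
  define P where "P n = (\<lambda>(g :: 'a \<Rightarrow> real, l :: real). 0 < l \<and> g p = 0 \<and> (\<forall>x\<in>S n. 0 \<le> g x) \<and>
      (\<forall>x\<in>S n. \<forall>y\<in>S n. g x \<le> g y + l * d x y) \<and> (\<forall>x\<in>S n - U. 1 < g x))"
    for n
  define E where "E n = (\<lambda>(g :: 'a \<Rightarrow> real, l :: real) (g' :: 'a \<Rightarrow> real, l' :: real). l \<le> l' \<and> (\<forall>x\<in>S n. g' x = g x))"
    for n
  \<comment> \<open>A sequence of pairs of a function and a Lipschitz constant.\<close>
  have "\<exists>gl. \<forall>n. P n (gl n) \<and> E n (gl n) (gl (Suc n))"
  proof (rule dependent_nat_choice)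
    have p_compact: "compactin mtopology {p}"
      using pM by (simp add: finite_imp_compactin)
    show "\<exists>gl. P 0 gl"
    proof (rule Lipschitz_extension_above_1[OF p_compact _ _ SM[of 0] SU[of 0], of 1 "\<lambda>_. 0"])
      fix g l assume g: "(1::real) \<le> l" "\<And>x. x \<in> {p} \<Longrightarrow> g x = (0::real)"
        "\<And>x. x \<in> S 0 \<Longrightarrow> 0 \<le> g x"
        "\<And>x y. x \<in> S 0 \<Longrightarrow> y \<in> S 0 \<Longrightarrow> g x \<le> g y + l * d x y" "\<And>x. x \<in> S 0 - U \<Longrightarrow> 1 < g x"
      have "P 0 (g, l)"
        using g by (simp add: P_def)
      then show ?thesis by blast
    qed (use p in auto)
  next
    fix gl n assume "P n gl"
    then obtain g l where gl: "gl = (g, l)" "0 < l" "g p = 0" "\<And>x. x \<in> S n \<Longrightarrow> 0 \<le> g x"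
      "\<And>x y. x \<in> S n \<Longrightarrow> y \<in> S n \<Longrightarrow> g x \<le> g y + l * d x y" "\<And>x. x \<in> S n - U \<Longrightarrow> 1 < g x"
      by (cases gl) (auto simp: P_def)
    have pS: "p \<in> S n" using p(1) lift_Suc_mono_le[of S 0 n] S(2) by blast
    show "\<exists>gl'. P (Suc n) gl' \<and> E n gl gl'"
    proof (rule Lipschitz_extension_above_1[OF S(1) _ S(2) SM SU, where L = l and f = g])
      fix g' l' assume g': "l \<le> l'" "\<And>x. x \<in> S n \<Longrightarrow> g' x = g x"
        "\<And>x. x \<in> S (Suc n) \<Longrightarrow> 0 \<le> g' x"
        "\<And>x y. x \<in> S (Suc n) \<Longrightarrow> y \<in> S (Suc n) \<Longrightarrow> g' x \<le> g' y + l' * d x y"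
        "\<And>x. x \<in> S (Suc n) - U \<Longrightarrow> 1 < g' x"
      have "P (Suc n) (g', l') \<and> E n gl (g', l')"
        using gl g' pS by (simp add: P_def E_def)
      then show ?thesis by blast
    qed (use gl pS in auto)
  qed
  then obtain gl where "\<And>n. P n (gl n)" "\<And>n. E n (gl n) (gl (Suc n))" by blast
  moreover define g where "g n = fst (gl n)" for n
  moreover define L where "L n = snd (gl n)" for n
  ultimately have P: "P n (g n, L n)" and E: "E n (g n, L n) (g (Suc n), L (Suc n))" for n
    by auto
  have eq: "g n x = g m x" if "m \<le> n" "x \<in> S m" for m n x
    using that(1)
  proof (induction n rule: dec_induct)
    case (step k)
    have "x \<in> S k" using that(2) lift_Suc_mono_le[of S m k] S(2) step(1) by blast
    then show ?case using E[of k] step by (simp add: E_def)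
  qed simp
  define f where "f x = g (LEAST n. x \<in> S n) x" for x
  have f: "f x = g n x" if "x \<in> S n" for n x
    unfolding f_def using eq[of "LEAST n. x \<in> S n" n x] that
    by (metis LeastI Least_le)
  show ?thesis
  proof
    show "0 < L 0" using P[of 0] by (simp add: P_def)
    show "incseq L" using E by (auto simp: E_def intro: incseq_SucI)
    show "f p = 0" using f[OF p(1)] P[of 0] by (simp add: P_def)
    show "f x \<le> f y + L n * d x y" if "x \<in> S n" "y \<in> S n" for n x y
      using f that P[of n] by (simp add: P_def)
    show "1 < f x" if "x \<in> S n - U" for n x
      using f[of x n] that P[of n] by (simp add: P_def)
  qed
qed

section \<open>Weighted balls\<close>

lemma relation_length_nonneg:
  assumes "weight \<omega>" "surjective_relation A B R" "A \<in> Ran M" "B \<in> Ran M"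
  shows "0 \<le> relation_length d \<omega> R" "(\<Sum>(x, y)\<in>R. d x y) \<le> relation_length d \<omega> R"
proof -
  have "1 \<le> \<omega> (card R)"
    using assms(1) surjective_relation_card_ge_1[OF assms(2-4)] by (simp add: weight_def)
  moreover have "0 \<le> (\<Sum>(x, y)\<in>R. d x y)"
    by (auto intro: sum_nonneg)
  ultimately show "(\<Sum>(x, y)\<in>R. d x y) \<le> relation_length d \<omega> R"
    unfolding relation_length_def using mult_right_mono by fastforce
  then show "0 \<le> relation_length d \<omega> R"
    using \<open>0 \<le> (\<Sum>(x, y)\<in>R. d x y)\<close> by simp
qed

lemma chain_length_nonneg:
  assumes "weight \<omega>" "combinatorial_chain M X Y k Xs Rs"
  shows "0 \<le> chain_length d \<omega> k Rs"
  unfolding chain_length_def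
proof (rule sum_nonneg)
  fix j assume "j \<in> {..<k}"
  then have "surjective_relation (Xs j) (Xs (Suc j)) (Rs j)" "Xs j \<in> Ran M" "Xs (Suc j) \<in> Ran M"
    using assms(2) by (auto simp: combinatorial_chain_def)
  then show "0 \<le> relation_length d \<omega> (Rs j)"
    using relation_length_nonneg(1)[OF assms(1)] by blast
qed

lemma weighted_dist_less_iff:
  assumes w: "weight \<omega>" and XY: "X \<in> Ran M" "Y \<in> Ran M"
  shows "weighted_dist M d \<omega> X Y < r \<longleftrightarrow>
    (\<exists>k Xs Rs. combinatorial_chain M X Y k Xs Rs \<and> chain_length d \<omega> k Rs < r)"
proof -
  let ?C = "{chain_length d \<omega> k Rs | k Xs Rs. combinatorial_chain M X Y k Xs Rs}"
  have "combinatorial_chain M X Y 1 (\<lambda>j. if j = 0 then X else Y) (\<lambda>_. X \<times> Y)"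
    using XY surjective_relation_Times[OF XY] by (auto simp: combinatorial_chain_def)
  then have "?C \<noteq> {}" by blast
  moreover have "bdd_below ?C"
    using chain_length_nonneg[OF w] by (intro bdd_belowI[of _ 0]) blast
  ultimately show ?thesis
    unfolding weighted_dist_def using cInf_less_iff[of ?C r] by blast
qed

lemma combinatorial_chain_snoc:
  assumes "combinatorial_chain M X Y k Xs Rs" "surjective_relation Y Z R" "Z \<in> Ran M"
  shows "combinatorial_chain M X Z (Suc k) (Xs(Suc k := Z)) (Rs(k := R))"
    "chain_length d \<omega> (Suc k) (Rs(k := R)) = chain_length d \<omega> k Rs + relation_length d \<omega> R"
proof -
  show "combinatorial_chain M X Z (Suc k) (Xs(Suc k := Z)) (Rs(k := R))"
    using assms by (auto simp: combinatorial_chain_def less_Suc_eq le_Suc_eq)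
  show "chain_length d \<omega> (Suc k) (Rs(k := R)) = chain_length d \<omega> k Rs + relation_length d \<omega> R"
    by (simp add: chain_length_def)
qed

lemma centre_in_weighted_ball:
  assumes "weight \<omega>" "X \<in> Ran M" "0 < r"
  shows "X \<in> weighted_ball M d \<omega> X r"
proof -
  have "combinatorial_chain M X X 0 (\<lambda>_. X) (\<lambda>_. {})" "chain_length d \<omega> 0 (\<lambda>_. {}) < r"
    using assms by (auto simp: combinatorial_chain_def chain_length_def)
  then show ?thesis
    using weighted_dist_less_iff assms unfolding weighted_ball_def by blast
qed

lemma Ran_final_open_weighted_ball:
  assumes w: "weight \<omega>" and X: "X \<in> Ran M"
  shows "Ran_final_open mtopology (weighted_ball M d \<omega> X r)"
  unfolding Ran_final_open_def
proof (intro conjI allI impI)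
  show "weighted_ball M d \<omega> X r \<subseteq> Ran (topspace mtopology)"
    by (auto simp: weighted_ball_def)
  fix n :: nat assume n: "n \<ge> 1"
  let ?P = "product_topology (\<lambda>_. mtopology) {..<n}"
  let ?V = "{x \<in> topspace ?P. Ran_proj n x \<in> weighted_ball M d \<omega> X r}"
  show "openin ?P ?V"
  proof (subst openin_subopen, rule ballI)
    fix x assume xV: "x \<in> ?V"
    then have x: "x \<in> topspace ?P" and xR: "Ran_proj n x \<in> Ran M"
      by (auto simp: weighted_ball_def)
    obtain k Xs Rs where chain: "combinatorial_chain M X (Ran_proj n x) k Xs Rs"
      and len: "chain_length d \<omega> k Rs < r"
      using xV weighted_dist_less_iff[OF w X xR] by (auto simp: weighted_ball_def)
    define e where "e = (r - chain_length d \<omega> k Rs) / \<omega> n"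
    have wn: "1 \<le> \<omega> n" using w n by (simp add: weight_def)
    have "0 < e" using wn len by (simp add: e_def)
    then obtain W where W: "openin ?P W" "x \<in> W"
      and near: "\<And>y. y \<in> W \<Longrightarrow> (\<Sum>i<n. d (x i) (y i)) < e"
      using tuple_neighbourhood[OF x n] by metis
    have "y \<in> ?V" if "y \<in> W" for y
    proof -
      have y: "y \<in> topspace ?P"
        using W(1) that openin_subset by blast
      then have yR: "Ran_proj n y \<in> Ran M" using Ran_proj_in_Ran[OF n y] by simp
      obtain R where R: "surjective_relation (Ran_proj n x) (Ran_proj n y) R" "card R \<le> n"
        "(\<Sum>(a, b)\<in>R. d a b) \<le> (\<Sum>i<n. d (x i) (y i))"
        using tuple_relation[OF x y] by metis
      have "1 \<le> card R"
        using surjective_relation_card_ge_1[OF R(1) xR yR] .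
      then have "\<omega> (card R) \<le> \<omega> n"
        using w R(2) n by (auto simp: weight_def intro: mono_onD)
      then have "relation_length d \<omega> R \<le> \<omega> n * (\<Sum>(a, b)\<in>R. d a b)"
        unfolding relation_length_def by (intro mult_right_mono) (auto intro: sum_nonneg)
      also have "\<dots> < \<omega> n * e"
        using R(3) near[OF that] wn by (intro mult_strict_left_mono) auto
      also have "\<dots> = r - chain_length d \<omega> k Rs"
        using wn by (simp add: e_def)
      finally have "chain_length d \<omega> (Suc k) (Rs(k := R)) < r"
        using combinatorial_chain_snoc(2)[OF chain R(1) yR] by simp
      then have "weighted_dist M d \<omega> X (Ran_proj n y) < r"
        using weighted_dist_less_iff[OF w X yR] combinatorial_chain_snoc(1)[OF chain R(1) yR]
        by blast
      then show ?thesis using y yR by (simp add: weighted_ball_def)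
    qed
    with W show "\<exists>T. openin ?P T \<and> x \<in> T \<and> T \<subseteq> ?V" by blast
  qed
qed

lemma compact_neighbourhood_of_finite:
  assumes lc: "locally_compact_space mtopology" and X: "finite X" "X \<subseteq> M"
  obtains K \<rho> where "compactin mtopology K" "0 < \<rho>" "\<And>x. x \<in> X \<Longrightarrow> mcball x \<rho> \<subseteq> K"
proof -
  have "\<exists>C \<rho>. compactin mtopology C \<and> 0 < \<rho> \<and> mcball x \<rho> \<subseteq> C" if "x \<in> X" for x
  proof -
    have "x \<in> topspace mtopology" using that X by auto
    then obtain O' C where "openin mtopology O'" "compactin mtopology C" "x \<in> O'" "O' \<subseteq> C"
      using lc unfolding locally_compact_space_def by blast
    then show ?thesis
      unfolding openin_mtopology_mcball by (meson order_trans)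
  qed
  then obtain C \<rho> where C: "\<And>x. x \<in> X \<Longrightarrow> compactin mtopology (C x) \<and> 0 < \<rho> x \<and> mcball x (\<rho> x) \<subseteq> C x"
    by metis
  define \<sigma> where "\<sigma> = Min (insert 1 (\<rho> ` X))"
  show ?thesis
  proof
    show "compactin mtopology (\<Union>x\<in>X. C x)"
      using X(1) C by (intro compactin_Union) auto
    show "0 < \<sigma>" using X(1) C by (simp add: \<sigma>_def)
    fix x assume x: "x \<in> X"
    have "\<sigma> \<le> \<rho> x" using X(1) x by (simp add: \<sigma>_def)
    then have "mcball x \<sigma> \<subseteq> mcball x (\<rho> x)" by (rule mcball_subset_concentric)
    then show "mcball x \<sigma> \<subseteq> (\<Union>x\<in>X. C x)" using C x by blast
  qed
qed

text \<open>
  The weight is the sequence of Lipschitz constants of the separating function, divided by the first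
  constant \<open>L 0\<close>. The exhaustion starts with \<open>card X\<close> points, so that it contains \<open>X\<close> from the
  beginning; the first constant serves for all smaller cardinalities.
\<close>

lemma weighted_ball_inside_final_open:
  assumes lc: "locally_compact_space mtopology" and U: "Ran_final_open mtopology U" and XU: "X \<in> U"
  obtains \<omega> r where "weight \<omega>" "0 < r" "weighted_ball M d \<omega> X r \<subseteq> U"
proof -
  interpret H: Metric_space "Ran M" "hausdorff_dist M d" by (rule Metric_space_hausdorff)
  have XR: "X \<in> Ran M" using U XU by (auto simp: Ran_final_open_def)
  then have X: "finite X" "X \<subseteq> M" "X \<noteq> {}" by (auto simp: Ran_def)
  obtain K \<rho> where K: "compactin mtopology K" and \<rho>: "0 < \<rho>"
    and ball: "\<And>x. x \<in> X \<Longrightarrow> mcball x \<rho> \<subseteq> K"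
    using compact_neighbourhood_of_finite[OF lc X(1,2)] by metis
  have inK: "A \<in> Ran K" if A: "A \<in> Ran M" "hausdorff_dist M d X A < \<rho>" for A
  proof -
    have "hausdorff_close d \<rho> X A"
      using hausdorff_dist_less_imp_close[OF XR A] .
    have "A \<subseteq> K"
    proof
      fix a assume a: "a \<in> A"
      then obtain x where x: "x \<in> X" "d x a \<le> \<rho>"
        using \<open>hausdorff_close d \<rho> X A\<close> unfolding hausdorff_close_def by blast
      then have "a \<in> mcball x \<rho>"
        using a A(1) X(2) by (auto simp: Ran_def)
      then show "a \<in> K" using ball[OF x(1)] by blast
    qed
    then show ?thesis using A(1) by (simp add: Ran_def)
  qed
  define m where "m = card X"
  have m: "m \<ge> 1" using X by (simp add: m_def Suc_le_eq card_gt_0_iff)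
  define S where "S n = {A \<in> Ran K. card A \<le> m + n}" for n
  have XS: "X \<in> S 0"
    using inK[OF XR] XR \<rho> by (simp add: S_def m_def)
  obtain f L where L0: "0 < L 0" and L: "incseq L" and fX: "f X = 0"
    and lip: "\<And>n A B. A \<in> S n \<Longrightarrow> B \<in> S n \<Longrightarrow> f A \<le> f B + L n * hausdorff_dist M d A B"
    and f1: "\<And>n A. A \<in> S n - U \<Longrightarrow> 1 < f A"
  proof (rule H.Lipschitz_separation_on_union[of S U X])
    show "compactin H.mtopology (S n)" for n
      unfolding S_def using m by (intro compactin_bounded_card[OF K]) simp
    show "compactin H.mtopology (S n - U)" for n
      unfolding S_def using m by (intro compactin_bounded_card_minus_open[OF K _ U]) simp
    show "S n \<subseteq> S (Suc n)" for n
      by (auto simp: S_def)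
  qed (use XS XU in auto)
  \<comment> \<open>The subtraction truncates: the weight is 1 up to m = card X, in particular at 1.\<close>
  define \<omega> where "\<omega> k = L (k - m) / L 0" for k
  have w: "weight \<omega>"
    unfolding weight_def
  proof (intro conjI allI impI)
    show "1 \<le> \<omega> n" for n
      using L0 incseqD[OF L, of 0 "n - m"] by (simp add: \<omega>_def)
    show "mono_on {1..} \<omega>"
      using L0 by (auto simp: \<omega>_def mono_on_def intro!: divide_right_mono incseqD[OF L])
    show "\<omega> 1 = 1"
      using L0 m by (simp add: \<omega>_def)
  qed
  have step: "f B \<le> f A + L 0 * relation_length d \<omega> R"
    if AB: "A \<in> Ran K" "B \<in> Ran K" "A \<in> Ran M" "B \<in> Ran M" and R: "surjective_relation A B R"
    for A B R
  proof -
    have "finite R" using surjective_relation_finite[OF R AB(1,2)] .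
    then have "A \<in> S (card R - m)" "B \<in> S (card R - m)"
      using surjective_relation_card[OF R] AB by (auto simp: S_def)
    then have "f B \<le> f A + L (card R - m) * hausdorff_dist M d A B"
      using lip hausdorff_dist_commute by metis
    also have "0 \<le> L (card R - m)"
      using L0 incseqD[OF L, of 0 "card R - m"] by simp
    then have "L (card R - m) * hausdorff_dist M d A B \<le> L (card R - m) * (\<Sum>(x, y)\<in>R. d x y)"
      by (intro mult_left_mono hausdorff_dist_le_relation[OF R] AB)
    also have "\<dots> = L 0 * relation_length d \<omega> R"
      using L0 by (simp add: relation_length_def \<omega>_def)
    finally show ?thesis by simp
  qed
  \<comment> \<open>The first bound confines chains to K, the second keeps f below 1.\<close>
  define r where "r = min \<rho> (1 / L 0)"
  have "Y \<in> U" if Y: "Y \<in> weighted_ball M d \<omega> X r" for Y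
  proof -
    have YR: "Y \<in> Ran M" using Y by (simp add: weighted_ball_def)
    obtain k Xs Rs where chain: "combinatorial_chain M X Y k Xs Rs"
      and len: "chain_length d \<omega> k Rs < r"
      using Y weighted_dist_less_iff[OF w XR YR] by (auto simp: weighted_ball_def)
    have XsM: "Xs j \<in> Ran M" if "j \<le> k" for j
      using chain that by (simp add: combinatorial_chain_def)
    have R: "surjective_relation (Xs j) (Xs (Suc j)) (Rs j)" if "j < k" for j
      using chain that by (simp add: combinatorial_chain_def)
    have pos: "0 \<le> relation_length d \<omega> (Rs j)" if "j < k" for j
      using relation_length_nonneg(1)[OF w R[OF that]] XsM that by simp
    have mono: "chain_length d \<omega> j Rs \<le> chain_length d \<omega> k Rs" if "j \<le> k" for j
      unfolding chain_length_def using that pos by (intro sum_mono2) auto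
    \<comment> \<open>Both estimates go together: the step for f needs that Xs (Suc j) is still inside K.\<close>
    have inv: "hausdorff_dist M d X (Xs j) \<le> chain_length d \<omega> j Rs \<and>
        f (Xs j) \<le> L 0 * chain_length d \<omega> j Rs" if "j \<le> k" for j
      using that
    proof (induction j)
      case 0
      then show ?case
        using chain fX XR by (simp add: combinatorial_chain_def chain_length_def)
    next
      case (Suc j)
      then have j: "j < k" "j \<le> k" by auto
      have len': "chain_length d \<omega> (Suc j) Rs = chain_length d \<omega> j Rs + relation_length d \<omega> (Rs j)"
        by (simp add: chain_length_def)
      have "hausdorff_dist M d (Xs j) (Xs (Suc j)) \<le> relation_length d \<omega> (Rs j)"
        using hausdorff_dist_le_relation[OF R[OF j(1)]] relation_length_nonneg(2)[OF w R[OF j(1)]]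
          XsM j Suc.prems by fastforce
      then have dist: "hausdorff_dist M d X (Xs (Suc j)) \<le> chain_length d \<omega> (Suc j) Rs"
        using H.triangle[OF XR XsM[OF j(2)] XsM[OF Suc.prems]] Suc.IH[OF j(2)] len' by simp
      have "Xs j \<in> Ran K" "Xs (Suc j) \<in> Ran K"
        using inK XsM j(2) Suc.prems Suc.IH[OF j(2)] dist mono[OF j(2)] mono[OF Suc.prems] len
        by (auto simp: r_def)
      then have "f (Xs (Suc j)) \<le> f (Xs j) + L 0 * relation_length d \<omega> (Rs j)"
        using step R[OF j(1)] XsM j(2) Suc.prems by blast
      then show ?case
        using Suc.IH[OF j(2)] dist len' by (simp add: distrib_left)
    qed
    have Xk: "Xs k = Y" using chain by (simp add: combinatorial_chain_def)
    have YK: "Y \<in> Ran K"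
      using inK[OF YR] inv[of k] len Xk by (simp add: r_def)
    have "chain_length d \<omega> k Rs < 1 / L 0" using len by (simp add: r_def)
    then have "f Y < 1"
      using inv[of k] Xk L0 by (simp add: field_simps)
    moreover have "Y \<in> S (card Y)" using YK by (simp add: S_def)
    ultimately show "Y \<in> U"
      using f1[of Y "card Y"] by fastforce
  qed
  moreover have "0 < r" using \<rho> L0 by (simp add: r_def)
  ultimately show ?thesis using that[OF w] by blast
qed

end

section \<open>The basis theorem\<close>

theorem theorem1:
  fixes M :: "'a set" and d :: "'a \<Rightarrow> 'a \<Rightarrow> real"
  assumes "Metric_space M d"
    and "locally_compact_space (Metric_space.mtopology M d)"
  shows "topology_basis (Ran_final_topology (Metric_space.mtopology M d))
           {weighted_ball M d \<omega> X r | \<omega> X r. X \<in> Ran M \<and> r > 0 \<and> weight \<omega>}"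
proof -
  interpret Metric_space M d by (rule assms(1))
  let ?B = "{weighted_ball M d \<omega> X r | \<omega> X r. X \<in> Ran M \<and> r > 0 \<and> weight \<omega>}"
  show ?thesis
    unfolding topology_basis_def openin_Ran_final_topology
  proof (intro conjI ballI allI impI)
    show "Ran_final_open mtopology B" if "B \<in> ?B" for B
      using that Ran_final_open_weighted_ball by blast
  next
    fix U assume U: "Ran_final_open mtopology U"
    have "U \<subseteq> \<Union>{B \<in> ?B. B \<subseteq> U}"
    proof
      fix X assume X: "X \<in> U"
      then have XR: "X \<in> Ran M" using U by (auto simp: Ran_final_open_def)
      obtain \<omega> r where w: "weight \<omega>" "0 < r" "weighted_ball M d \<omega> X r \<subseteq> U"
        using weighted_ball_inside_final_open[OF assms(2) U X] by metis
      then have "weighted_ball M d \<omega> X r \<in> {B \<in> ?B. B \<subseteq> U}" using XR by blast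
      then show "X \<in> \<Union>{B \<in> ?B. B \<subseteq> U}"
        using centre_in_weighted_ball[OF w(1) XR w(2)] by blast
    qed
    then show "\<exists>\<B>'\<subseteq>?B. \<Union>\<B>' = U"
      by (intro exI[of _ "{B \<in> ?B. B \<subseteq> U}"]) blast
  qed
qed

end
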